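(* Let $n$ be a positive integer. Let $L = \{\frac{a_1}{b_1}, \ldots , \frac{a_s}{b_s}\}$, where for every $i \in [s]$, $\frac{a_i}{b_i} \in [0,1)$ is an irreducible fraction. Let $\mathcal{F}$ be a fractional $L$-intersecting family of subsets of $[n]$. Let $t = \max(s,\max(b_i:i \in [s]))$ and $g(t,n) = \frac{2(2t + \ln n)}{\ln(2t + \ln n)}$. Then $$|\mathcal{F}| \leq 2{n \choose s} g^2(t,n)\ln(g(t,n)) + \left(\sum_{i=1}^{s-1} {n \choose i}\right)g(t,n).$$ Further, (a) if $s \leq n+1 - 2g(t,n)\ln(g(t,n))$, then $|\mathcal{F}| \leq 2{n \choose s} g^2(t,n)\ln(g(t,n))$, and (b) if $c_1$ is a positive integer and $t > n-c_1$, then $|\mathcal{F}| \leq 2c_1 {n \choose s}g(t,n)\ln(g(t,n)) + c_1\sum_{i=1}^{s-1} {n \choose i}$.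
   Context: $[n]=\{1,\ldots,n\}$. A family $\mathcal{F}=\{A_1,\ldots,A_m\}$ of (distinct) subsets of $[n]$ is a fractional $L$-intersecting family if for every distinct $i,j\in[m]$ there exists $\frac{a}{b}\in L$ such that $|A_i\cap A_j|\in\{\frac{a}{b}|A_i|,\frac{a}{b}|A_j|\}$. Convention: ${a \choose b}=0$ when $b>a$.
   Formalization: In (b), the case c_1 = 1, s > n with F the full power set of [n] is excluded: there the bound equals 2^n − 1 < 2^n = |F|, so the claim fails (e.g. n = 1, L = {0, 1/2}, F = {∅, {1}}). *)

theory Defs
  imports Complex_Main
begin

definition fractional_intersecting_family :: "nat \<Rightarrow> real set \<Rightarrow> nat set set \<Rightarrow> bool" where
  "fractional_intersecting_family n L F \<longleftrightarrow>
     F \<subseteq> Pow {1..n} \<and>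
     (\<forall>A\<in>F. \<forall>B\<in>F. A \<noteq> B \<longrightarrow>
        (\<exists>l\<in>L. real (card (A \<inter> B)) \<in> {l * real (card A), l * real (card B)}))"

definition g :: "nat \<Rightarrow> nat \<Rightarrow> real" where
  "g t n = 2 * (2 * real t + ln (real n)) / ln (2 * real t + ln (real n))"

text \<open>
  The bound \<open>2 c1 (n choose s) g ln g + c1 (\<Sum>i=1..s-1. n choose i)\<close> for \<open>t > n - c1\<close> degenerates
  when \<open>s > n\<close> and \<open>c1 = 1\<close>: it is then the number \<open>2^n - 1\<close> of nonempty subsets, so it fails exactly
  when the family is the whole power set, empty set included. Such families exist, for example
  with \<open>n = 1\<close>, \<open>L = {0/1, 1/2}\<close>, \<open>s = t = 2\<close>. The two lemmas below establish this; the theorem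
  excludes exactly this case from that bound.
\<close>

lemma fractional_intersecting_family_Pow_1:
  "fractional_intersecting_family 1 {0 / 1, 1 / 2} (Pow {1..1})"
  by (auto simp: fractional_intersecting_family_def Pow_insert)

lemma bound_degenerates_when_s_gt_n:
  assumes "s > n"
  shows "2 * real 1 * real (n choose s) * G * ln G + real 1 * (\<Sum>i = 1..s - 1. real (n choose i))
         = real (card (Pow {1..n})) - 1"
proof -
  have "(\<Sum>i = 1..s - 1. n choose i) = (\<Sum>i = 1..n. n choose i)"
    using assms by (intro sum.mono_neutral_right) auto
  moreover have "(\<Sum>i = 0..n. n choose i) = 1 + (\<Sum>i = 1..n. n choose i)"
    by (simp add: sum.atLeast_Suc_atMost)
  ultimately have "1 + (\<Sum>i = 1..s - 1. n choose i) = 2 ^ n"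
    using choose_row_sum[of n] by (simp add: atMost_atLeast0)
  then have "1 + (\<Sum>i = 1..s - 1. real (n choose i)) = 2 ^ n"
    by (metis of_nat_1 of_nat_add of_nat_numeral of_nat_power of_nat_sum)
  then show ?thesis
    using assms by (simp add: card_Pow binomial_eq_0 algebra_simps)
qed

end

theory Submission
  imports
    Defs
    "HOL-Library.Function_Algebras"
    "HOL-Computational_Algebra.Primes"
    "HOL-Analysis.Harmonic_Numbers"
    "HOL-Analysis.Complex_Transcendental"
begin

text \<open>
  Let \<open>p > t\<close> be prime. The members of the family whose size is congruent to a fixed \<open>j \<noteq> 0\<close>
  modulo \<open>p\<close> intersect modulo \<open>p\<close> in one of the \<open>s\<close> residues \<open>(a\<^sub>i / b\<^sub>i) j \<noteq> j\<close>, so the polynomial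
  method bounds their number by \<open>S = (\<Sum>i\<le>s. n choose i)\<close>, and
  \<open>(n - 2 s + 1) S \<le> (n - s + 1) (n choose s)\<close>.

  A prime \<open>p > n\<close> separates all sizes. Bounding the uniform layers \<open>k < s\<close> and \<open>k > n - s\<close>
  trivially gives \<open>|F| \<le> (\<Sum>i=1..s-1. n choose i) + (n + 2) (n choose s)\<close>. With \<open>x = 2 t + ln n\<close>
  one has \<open>2 g ln g \<ge> 13/4 x \<ge> 13/2 t\<close>, which settles (b), and the other bounds as long as
  \<open>2 g\<^sup>2 ln g \<ge> n + 4\<close>.

  Otherwise \<open>s\<close> is so small compared to \<open>n\<close> that \<open>S \<le> 21/20 (n choose s)\<close>. If the product of a
  set \<open>P\<close> of primes above \<open>t\<close> exceeds \<open>n\<close>, every nonempty member has size prime to some \<open>p \<in> P\<close>,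
  whence \<open>|F| \<le> 1 + S (\<Sum>p\<in>P. p - 1)\<close>. Chebyshev's estimates provide such a \<open>P\<close> with
  \<open>1 + 21/20 (\<Sum>p\<in>P. p - 1) \<le> 13/2 x\<^sup>2 / ln x \<le> 2 g\<^sup>2 ln g\<close>.
\<close>

subsection \<open>The polynomial method modulo a prime\<close>

interpretation rat_fun: vector_space "\<lambda>(c::rat) (f :: 'x \<Rightarrow> rat) x. c * f x"
  by unfold_locales (auto simp: fun_eq_iff algebra_simps)

text \<open>Descent in one stroke: after division of the coefficients by their gcd \<open>G\<close>,
  the relation at \<open>B\<close> modulo \<open>p\<close> keeps only the diagonal term, so
  \<open>p\<close> divides every reduced coefficient. Then \<open>G * p\<close> divides all
  \<open>c B\<close>, hence their gcd, which is absurd.\<close>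

lemma int_combination_zero_mod_prime:
  fixes c :: "'a \<Rightarrow> int" and M :: "'a \<Rightarrow> 'a \<Rightarrow> int"
  assumes "finite C" "prime p"
    and diag: "\<And>A. A \<in> C \<Longrightarrow> \<not> p dvd M A A"
    and off: "\<And>A B. A \<in> C \<Longrightarrow> B \<in> C \<Longrightarrow> A \<noteq> B \<Longrightarrow> p dvd M A B"
    and comb: "\<And>B. B \<in> C \<Longrightarrow> (\<Sum>A\<in>C. c A * M A B) = 0"
    and "A \<in> C"
  shows "c A = 0"
proof (rule ccontr)
  assume "c A \<noteq> 0"
  define G where "G = Gcd (c ` C)"
  have "G \<noteq> 0"
    using \<open>c A \<noteq> 0\<close> \<open>A \<in> C\<close> by (auto simp: G_def)
  define d where "d B = c B div G" for B
  have c: "c B = G * d B" if "B \<in> C" for B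
    using that by (simp add: d_def G_def)
  have "p dvd d B" if B: "B \<in> C" for B
  proof -
    have "G * (\<Sum>A\<in>C. d A * M A B) = (\<Sum>A\<in>C. c A * M A B)"
      by (simp add: sum_distrib_left c mult.assoc)
    then have "(\<Sum>A\<in>C. d A * M A B) = 0"
      using comb[OF B] \<open>G \<noteq> 0\<close> by simp
    then have "d B * M B B = - (\<Sum>A\<in>C - {B}. d A * M A B)"
      using B \<open>finite C\<close> by (simp add: sum.remove)
    moreover have "p dvd (\<Sum>A\<in>C - {B}. d A * M A B)"
      using off B by (intro dvd_sum) auto
    ultimately have "p dvd d B * M B B" by simp
    then show ?thesis
      using diag[OF B] \<open>prime p\<close> by (simp add: prime_dvd_mult_iff)
  qed
  then have "G * p dvd c B" if "B \<in> C" for B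
    using that c[OF that] by (simp add: mult_dvd_mono)
  then have "G * p dvd Gcd (c ` C)"
    by (intro Gcd_greatest) auto
  then have "is_unit p"
    using \<open>G \<noteq> 0\<close> by (simp add: G_def[symmetric])
  then show False
    using \<open>prime p\<close> not_prime_unit by blast
qed

lemma common_denominator:
  fixes c :: "'a \<Rightarrow> rat"
  assumes "finite C"
  shows "\<exists>D::int. D \<noteq> 0 \<and> (\<forall>A\<in>C. of_int D * c A \<in> \<int>)"
  using assms
proof induction
  case empty
  show ?case by (intro exI[of _ 1]) auto
next
  case (insert A C)
  then obtain D where D: "D \<noteq> 0" "\<forall>A\<in>C. of_int D * c A \<in> \<int>" by auto
  obtain k m where km: "c A = of_int k / of_int m" "m > 0"
    using quotient_of_div quotient_of_denom_pos by (metis surj_pair)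
  have "of_int (D * m) * c A = of_int (D * k)"
    using km by simp
  moreover have "of_int (D * m) * c B = of_int m * (of_int D * c B)" for B
    by simp
  ultimately have "\<forall>B\<in>insert A C. of_int (D * m) * c B \<in> \<int>"
    using D(2) by (metis Ints_mult Ints_of_int insertE)
  then show ?case
    using D(1) km(2) by (intro exI[of _ "D * m"]) simp
qed

lemma sum_fun_apply: "(\<Sum>i\<in>S. f i) x = (\<Sum>i\<in>S. f i x)"
  by (induction S rule: infinite_finite_induct) auto

text \<open>An integer matrix that is diagonal and nonsingular modulo \<open>p\<close> is nonsingular over the
  rationals; this replaces linear algebra over the field with \<open>p\<close> elements.\<close>

lemma card_le_span_mod_prime:
  fixes f :: "'a \<Rightarrow> 'a \<Rightarrow> int"
  assumes "finite C" "finite S" "prime p"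
    and span: "\<And>A. A \<in> C \<Longrightarrow> (\<lambda>X. rat_of_int (f A X)) \<in> rat_fun.span S"
    and diag: "\<And>A. A \<in> C \<Longrightarrow> \<not> p dvd f A A"
    and off: "\<And>A B. A \<in> C \<Longrightarrow> B \<in> C \<Longrightarrow> A \<noteq> B \<Longrightarrow> p dvd f A B"
  shows "card C \<le> card S"
proof -
  let ?h = "\<lambda>A X. rat_of_int (f A X)"
  \<comment> \<open>If distinct \<open>A\<close> and \<open>B\<close> induced the same function,
    \<open>f A B = f B B\<close> would be both divisible and not divisible by
    \<open>p\<close>.\<close>
  have inj: "inj_on ?h C"
    by (rule inj_onI) (metis diag off of_int_eq_iff)
  have "rat_fun.independent (?h ` C)"
    unfolding rat_fun.independent_explicit_finite_subsets
  proof (intro allI impI ballI)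
    fix T u v
    assume T: "T \<subseteq> ?h ` C" "finite T"
      and u: "(\<Sum>v\<in>T. (\<lambda>x. u v * v x)) = 0" and v: "v \<in> T"
    define C' where "C' = {A \<in> C. ?h A \<in> T}"
    have C': "finite C'" "T = ?h ` C'" "inj_on ?h C'"
      using T \<open>finite C\<close> inj by (auto simp: C'_def intro: inj_on_subset)
    obtain D :: int where D: "D \<noteq> 0" "\<forall>A\<in>C'. of_int D * u (?h A) \<in> \<int>"
      using common_denominator[OF C'(1), of "\<lambda>A. u (?h A)"] by blast
    then have "\<forall>A\<in>C'. \<exists>k. of_int D * u (?h A) = of_int k"
      by (auto elim: Ints_cases)
    then obtain k where k: "\<And>A. A \<in> C' \<Longrightarrow> of_int D * u (?h A) = of_int (k A)"
      by metis
    \<comment> \<open>Evaluation at \<open>B\<close> and multiplication by the common denominator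
      \<open>D\<close> turn the rational relation between functions into an integer one.\<close>
    have sum0: "(\<Sum>A\<in>C'. k A * f A B) = 0" for B
    proof -
      have "0 = of_int D * (\<Sum>v\<in>T. (\<lambda>x. u v * v x)) B"
        by (simp add: u)
      also have "\<dots> = of_int D * (\<Sum>A\<in>C'. u (?h A) * ?h A B)"
        using C' by (simp add: sum.reindex sum_fun_apply)
      also have "\<dots> = of_int (\<Sum>A\<in>C'. k A * f A B)"
        by (simp add: sum_distrib_left k[symmetric] mult.assoc)
      finally show ?thesis by (metis of_int_eq_0_iff)
    qed
    obtain A where A: "A \<in> C'" "v = ?h A"
      using v C'(2) by auto
    have "k A = 0"
      using \<open>prime p\<close> C'(1) A sum0 diag off
      by (intro int_combination_zero_mod_prime[of C' p f k]) (auto simp: C'_def)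
    then show "u v = 0"
      using k[of A] D(1) A by simp
  qed
  moreover have "?h ` C \<subseteq> rat_fun.span S"
    using span by auto
  ultimately have "card (?h ` C) \<le> card S"
    using rat_fun.independent_span_bound[OF \<open>finite S\<close>] by blast
  then show ?thesis
    by (simp add: card_image inj)
qed

text \<open>Monomials are represented by the functions they induce on subsets, so that they are
  multilinear: \<open>x\<^sub>I\<close> is the indicator of \<open>I \<subseteq> X\<close>.\<close>

definition monomials :: "nat \<Rightarrow> nat \<Rightarrow> (nat set \<Rightarrow> rat) set" where
  "monomials n s = (\<lambda>I X. of_bool (I \<subseteq> X)) ` {I. I \<subseteq> {1..n} \<and> card I \<le> s}"

lemma finite_monomials [simp]: "finite (monomials n s)"
  by (auto simp: monomials_def)

lemma card_subsets_card_le: "card {I. I \<subseteq> {1..n} \<and> card I \<le> s} = (\<Sum>i\<le>s. n choose i)"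
proof -
  have "{I. I \<subseteq> {1..n} \<and> card I \<le> s} = (\<Union>i\<le>s. {I. I \<subseteq> {1..n} \<and> card I = i})"
    by auto
  also have "card \<dots> = (\<Sum>i\<le>s. card {I. I \<subseteq> {1..n} \<and> card I = i})"
    by (intro card_UN_disjoint) auto
  finally show ?thesis
    by (simp add: n_subsets)
qed

lemma card_monomials_le: "card (monomials n s) \<le> (\<Sum>i\<le>s. n choose i)"
  unfolding monomials_def card_subsets_card_le[symmetric] by (intro card_image_le) auto

text \<open>On sets, the product of the i-th variable and the monomial of \<open>I\<close> is the
  monomial of \<open>insert i I\<close>, also when \<open>i\<close> already lies in
  \<open>I\<close>; so degrees grow by at most one and linearity does the rest.\<close>

lemma mult_var_span_monomials:
  assumes f: "f \<in> rat_fun.span (monomials n s)" and i: "i \<in> {1..n}"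
  shows "(\<lambda>X. of_bool (i \<in> X) * f X) \<in> rat_fun.span (monomials n (Suc s))"
  using f
proof (induction rule: rat_fun.span_induct_alt)
  case base
  show ?case
    using rat_fun.span_zero by (simp add: zero_fun_def)
next
  case (step c u v)
  obtain I where I: "I \<subseteq> {1..n}" "card I \<le> s" "u = (\<lambda>X. of_bool (I \<subseteq> X))"
    using step(1) by (auto simp: monomials_def)
  have "(\<lambda>X. of_bool (i \<in> X) * u X) = (\<lambda>X. of_bool (insert i I \<subseteq> X))"
    using I by auto
  also have "\<dots> \<in> monomials n (Suc s)"
    unfolding monomials_def using I i
    by (intro image_eqI[OF refl]) (auto simp: card_insert_if finite_subset[of I "{1..n}"])
  finally have "(\<lambda>X. c * (of_bool (i \<in> X) * u X)) \<in> rat_fun.span (monomials n (Suc s))"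
    by (intro rat_fun.span_scale rat_fun.span_base)
  from rat_fun.span_add[OF this step(2)] show ?case
    by (simp add: plus_fun_def algebra_simps)
qed

lemma span_monomials_mono: "rat_fun.span (monomials n s) \<subseteq> rat_fun.span (monomials n (Suc s))"
  by (intro rat_fun.span_mono) (auto simp: monomials_def)

text \<open>\<open>card (A \<inter> X)\<close> is the sum of the variables indexed by
  \<open>A\<close>, so every factor is affine and raises the degree by at most one.\<close>

lemma prod_affine_in_span_monomials:
  fixes \<alpha> \<beta> :: "nat \<Rightarrow> rat"
  assumes "A \<subseteq> {1..n}"
  shows "(\<lambda>X. \<Prod>l = 1..s. \<alpha> l * of_nat (card (A \<inter> X)) + \<beta> l) \<in> rat_fun.span (monomials n s)"
proof (induction s)
  case 0
  have "(\<lambda>X. 1) \<in> monomials n 0"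
    by (auto simp: monomials_def intro!: image_eqI[of _ _ "{}"])
  then show ?case
    by (simp add: rat_fun.span_base)
next
  case (Suc s)
  let ?f = "\<lambda>X. \<Prod>l = 1..s. \<alpha> l * of_nat (card (A \<inter> X)) + \<beta> l"
  have fin: "finite A"
    using assms finite_subset by blast
  have card: "(of_nat (card (A \<inter> X)) :: rat) = (\<Sum>i\<in>A. of_bool (i \<in> X))" for X
    using fin by (simp add: Int_def)
  have "(\<Sum>i\<in>A. (\<lambda>X. of_bool (i \<in> X) * ?f X)) \<in> rat_fun.span (monomials n (Suc s))"
    using assms by (intro rat_fun.span_sum mult_var_span_monomials Suc) auto
  then have "(\<lambda>X. \<alpha> (Suc s) * (\<Sum>i\<in>A. (\<lambda>X. of_bool (i \<in> X) * ?f X)) X)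
      + (\<lambda>X. \<beta> (Suc s) * ?f X) \<in> rat_fun.span (monomials n (Suc s))"
    using Suc span_monomials_mono by (intro rat_fun.span_add rat_fun.span_scale) auto
  also have "(\<lambda>X. \<alpha> (Suc s) * (\<Sum>i\<in>A. (\<lambda>X. of_bool (i \<in> X) * ?f X)) X) + (\<lambda>X. \<beta> (Suc s) * ?f X)
      = (\<lambda>X. \<Prod>l = 1..Suc s. \<alpha> l * of_nat (card (A \<inter> X)) + \<beta> l)"
    by (simp add: fun_eq_iff sum_fun_apply card sum_distrib_right[symmetric] algebra_simps)
  finally show ?case .
qed

subsection \<open>Chebyshev estimates\<close>

lemma prod_dvd_of_coprime:
  fixes m :: nat
  assumes "finite P" "\<And>p. p \<in> P \<Longrightarrow> p dvd m"
    and "\<And>p q. p \<in> P \<Longrightarrow> q \<in> P \<Longrightarrow> p \<noteq> q \<Longrightarrow> coprime p q"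
  shows "\<Prod>P dvd m"
  using assms
proof (induction P)
  case (insert p P)
  then have "coprime p (\<Prod>P)"
    by (intro prod_coprime_right) auto
  then show ?case
    using insert by (simp add: divides_mult)
qed auto

lemma finite_primes_le [simp]: "finite {p::nat. prime p \<and> p \<le> n}"
  by (rule finite_subset[of _ "{..n}"]) auto

text \<open>Row \<open>2 * m + 1\<close> contains this entry twice and sums to
  \<open>2 * 4 ^ m\<close>.\<close>

lemma odd_central_binomial_le: "(2 * m + 1) choose m \<le> 4 ^ m"
proof -
  have "2 * ((2 * m + 1) choose m) = (\<Sum>k\<in>{m, m + 1}. (2 * m + 1) choose k)"
    using binomial_symmetric[of m "2 * m + 1"] by simp
  also have "\<dots> \<le> (\<Sum>k\<le>2 * m + 1. (2 * m + 1) choose k)"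
    by (intro sum_mono2) auto
  also have "\<dots> = 2 * 4 ^ m"
    by (simp only: choose_row_sum power_add power_mult) simp
  finally show ?thesis by simp
qed

text \<open>Erdos's argument. For \<open>n = 2 * m + 1\<close> the primes above \<open>m + 1\<close>
  divide \<open>(2 * m + 1) choose m\<close>, because they divide the numerator factorial but
  neither \<open>fact m\<close> nor \<open>fact (m + 1)\<close>; the primes up to
  \<open>m + 1\<close> fall under the induction hypothesis. An even \<open>n > 2\<close> adds no
  prime.\<close>

lemma primorial_le: "\<Prod>{p::nat. prime p \<and> p \<le> n} \<le> 4 ^ n"
proof (induction n rule: less_induct)
  case (less n)
  consider "n \<le> 1" | "n = 2" | "n > 2" "even n" | m where "n = 2 * m + 1" "m > 0"
  proof -
    assume *: "n \<le> 1 \<Longrightarrow> thesis" "n = 2 \<Longrightarrow> thesis" "n > 2 \<Longrightarrow> even n \<Longrightarrow> thesis"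
      "\<And>m. n = 2 * m + 1 \<Longrightarrow> m > 0 \<Longrightarrow> thesis"
    show thesis
    proof (cases "even n")
      case True
      then show ?thesis using * by linarith
    next
      case False
      then obtain m where "n = 2 * m + 1" by (elim oddE)
      then show ?thesis using *(1,4) by (cases "m = 0") auto
    qed
  qed
  then show ?case
  proof cases
    case 1
    then have "{p::nat. prime p \<and> p \<le> n} = {}"
      by (auto dest: prime_gt_1_nat)
    then show ?thesis by (simp only:) simp
  next
    case 2
    then have "{p::nat. prime p \<and> p \<le> n} = {2}"
      by (auto dest: prime_ge_2_nat)
    then show ?thesis using 2 by (simp only:) simp
  next
    case 3
    then have "\<not> prime n"
      using primes_dvd_imp_eq two_is_prime_nat by blast
    then have "{p::nat. prime p \<and> p \<le> n} = {p. prime p \<and> p \<le> n - 1}"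
      by (auto simp: le_eq_less_or_eq)
    then have "\<Prod>{p::nat. prime p \<and> p \<le> n} \<le> 4 ^ (n - 1)"
      using less[of "n - 1"] 3 by simp
    also have "\<dots> \<le> 4 ^ n"
      by (intro power_increasing) auto
    finally show ?thesis .
  next
    case 4
    let ?P = "{p::nat. prime p \<and> m + 1 < p \<and> p \<le> 2 * m + 1}"
    have fin: "finite ?P"
      by (rule finite_subset[of _ "{..2 * m + 1}"]) auto
    have "p dvd (2 * m + 1) choose m" if p: "p \<in> ?P" for p
    proof -
      have "p dvd fact (2 * m + 1)"
        using p by (simp add: prime_dvd_fact_iff del: fact_Suc)
      also have "fact (2 * m + 1) = fact m * fact (m + 1) * ((2 * m + 1) choose m)"
        using binomial_fact_lemma[of m "2 * m + 1"] by simp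
      finally show ?thesis
        using p by (auto simp: prime_dvd_mult_iff prime_dvd_fact_iff simp del: fact_Suc)
    qed
    then have "\<Prod>?P dvd (2 * m + 1) choose m"
      using fin by (intro prod_dvd_of_coprime) (auto simp: primes_coprime)
    then have "\<Prod>?P \<le> (2 * m + 1) choose m"
      by (intro dvd_imp_le) auto
    also have "\<dots> \<le> 4 ^ m"
      by (rule odd_central_binomial_le)
    finally have "\<Prod>?P \<le> 4 ^ m" .
    moreover have "\<Prod>{p::nat. prime p \<and> p \<le> m + 1} \<le> 4 ^ (m + 1)"
      using 4 by (intro less) auto
    moreover have "{p::nat. prime p \<and> p \<le> n} = {p. prime p \<and> p \<le> m + 1} \<union> ?P"
      using 4 by auto
    then have "\<Prod>{p::nat. prime p \<and> p \<le> n} = \<Prod>{p. prime p \<and> p \<le> m + 1} * \<Prod>?P"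
      using fin by (simp only:) (rule prod.union_disjoint, auto)
    ultimately have "\<Prod>{p::nat. prime p \<and> p \<le> n} \<le> 4 ^ (m + 1) * 4 ^ m"
      by (simp only: mult_le_mono)
    also have "\<dots> = 4 ^ n"
      unfolding 4(1) by (simp add: mult_2 power_add)
    finally show ?thesis .
  qed
qed

text \<open>Leibniz's harmonic triangle: with \<open>l n k = 1 / ((n + 1) (n choose k))\<close> one has
  \<open>l (n + 1) (k + 1) = l n k - l (n + 1) k\<close>, so by induction on \<open>k\<close> the entries of the rows
  below \<open>N\<close> are integral combinations of \<open>1, 1/2, \<dots>, 1/N\<close>.\<close>

lemma Suc_times_binomial_dvd_Lcm:
  assumes "k \<le> n" "n < N"
  shows "Suc n * (n choose k) dvd Lcm {1..N}"
proof -
  let ?D = "real (Lcm {1..N})"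
  have "?D / (real (Suc n) * real (n choose k)) \<in> \<int>"
    using assms
  proof (induction k arbitrary: n)
    case 0
    then have "Suc n dvd Lcm {1..N}"
      by (intro dvd_Lcm) auto
    then obtain k where "Lcm {1..N} = Suc n * k"
      by (elim dvdE)
    then have "?D / (real (Suc n) * real (n choose 0)) = of_nat k"
      by (simp only: of_nat_mult) simp
    then show ?case
      by (simp only: Ints_of_nat)
  next
    case (Suc k)
    then obtain n' where n: "n = Suc n'" by (cases n) auto
    have pos: "real (n' choose k) > 0" "real (n choose k) > 0" "real (n choose Suc k) > 0"
      using Suc.prems n by (simp_all del: binomial_Suc_Suc)
    have 1: "real n * real (n' choose k) = real (Suc k) * real (n choose Suc k)"
      unfolding n using Suc_times_binomial_eq[of n' k] by (metis mult.commute of_nat_mult)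
    have 2: "real (n choose k) = real (n' choose k) * (real n / (real n - real k))"
    proof -
      have "(n - k) * (n choose k) = n * (n' choose k)"
        using binomial_absorb_comp[of n k] n by simp
      then have "real (n - k) * real (n choose k) = real n * real (n' choose k)"
        by (metis of_nat_mult)
      then show ?thesis
        using Suc.prems by (simp add: of_nat_diff field_simps)
    qed
    have "?D / (real (Suc n) * real (n choose Suc k))
        = ?D / (real (Suc n') * real (n' choose k)) - ?D / (real (Suc n) * real (n choose k))"
    proof -
      have 3: "real (n choose Suc k) = real n * real (n' choose k) / real (Suc k)"
        using 1 by (simp add: field_simps)
      have "real n - real k > 0" "real n > 0"
        using Suc.prems by auto
      then show ?thesis
        unfolding 2 3 using pos(1) n by (simp add: divide_simps) (simp add: algebra_simps)
    qed
    moreover have "?D / (real (Suc n') * real (n' choose k)) \<in> \<int>"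
      using Suc.prems n by (intro Suc.IH) auto
    moreover have "?D / (real (Suc n) * real (n choose k)) \<in> \<int>"
      using Suc.prems by (intro Suc.IH) auto
    ultimately show ?case
      by (simp only: Ints_diff)
  qed
  then obtain z where z: "?D / (real (Suc n) * real (n choose k)) = of_int z"
    by (elim Ints_cases)
  have "real (Suc n) * real (n choose k) > 0"
    using assms by auto
  then have "?D = of_int z * (real (Suc n) * real (n choose k))"
    using z by (simp add: field_simps)
  then have "of_int (int (Lcm {1..N})) = (of_int (z * int (Suc n * (n choose k))) :: real)"
    by (simp only: of_int_mult of_int_of_nat_eq of_nat_mult)
  then have "int (Lcm {1..N}) = z * int (Suc n * (n choose k))"
    by (simp only: of_int_eq_iff)
  then have "int (Suc n * (n choose k)) dvd int (Lcm {1..N})"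
    by (metis dvd_triv_right)
  then show ?thesis
    by (simp only: int_dvd_int_iff)
qed

text \<open>Row \<open>2 * m\<close> sums to \<open>4 ^ m\<close> and has \<open>2 * m + 1\<close>
  entries, none above the central one; that number of central entries divides the
  \<open>Lcm\<close>.\<close>

lemma four_power_le_Lcm: "4 ^ m \<le> Lcm {1..2 * m + 1::nat}"
proof -
  have "4 ^ m = (\<Sum>k\<le>2 * m. (2 * m) choose k)"
    by (simp add: choose_row_sum power_mult)
  also have "\<dots> \<le> (\<Sum>k\<le>2 * m. (2 * m) choose m)"
    by (intro sum_mono binomial_maximum')
  also have "\<dots> = Suc (2 * m) * ((2 * m) choose m)"
    by simp
  also have "\<dots> \<le> Lcm {1..2 * m + 1}"
  proof (rule dvd_imp_le)
    show "Suc (2 * m) * ((2 * m) choose m) dvd Lcm {1..2 * m + 1}"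
      by (rule Suc_times_binomial_dvd_Lcm) auto
    have "Lcm {1..2 * m + 1} \<noteq> 0"
      by (subst Lcm_0_iff) auto
    then show "Lcm {1..2 * m + 1} > 0" by (simp only: neq0_conv)
  qed
  finally show ?thesis .
qed

text \<open>A prime enters the \<open>Lcm\<close> as its largest power not exceeding
  \<open>y\<close>. This is at most \<open>y\<close> for the few primes up to the root of
  \<open>y\<close>, and just \<open>p\<close> for the others.\<close>

lemma Lcm_upto_le:
  fixes y :: nat
  assumes "y > 0"
  shows "Lcm {1..y} \<le> y ^ card {p. prime p \<and> p\<^sup>2 \<le> y} * \<Prod>{p. prime p \<and> y < p\<^sup>2 \<and> p \<le> y}"
proof -
  define e where "e p = (GREATEST k. p ^ k \<le> y)" for p
  let ?S = "{p. prime p \<and> p\<^sup>2 \<le> y}" and ?L = "{p. prime p \<and> y < p\<^sup>2 \<and> p \<le> y}"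
  let ?A = "{p. prime p \<and> p \<le> y}"
  \<comment> \<open>\<open>GREATEST\<close> is meaningful only for a bounded set of
    exponents.\<close>
  have bound: "k \<le> y" if "prime p" "p ^ k \<le> y" for p k :: nat
  proof -
    have "k < 2 ^ k" by simp
    also have "\<dots> \<le> p ^ k"
      using that by (intro power_mono prime_ge_2_nat) auto
    finally show ?thesis using that by simp
  qed
  have e_pow: "p ^ e p \<le> y" if "prime p" for p
    unfolding e_def using assms bound[OF that]
    by (intro GreatestI_nat[of "\<lambda>k. p ^ k \<le> y" 0 y]) auto
  have le_e: "k \<le> e p" if "prime p" "p ^ k \<le> y" for p k
    unfolding e_def using that bound[OF that(1)] by (intro Greatest_le_nat[of _ _ y]) auto
  have fin: "finite ?A" "finite ?L" "finite ?S"
    by (auto intro!: finite_subset[of _ "{..y}"] intro: order_trans[OF le_square, folded power2_eq_square])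
  have "Lcm {1..y} dvd (\<Prod>p\<in>?A. p ^ e p)"
  proof (intro Lcm_least)
    fix i assume i: "i \<in> {1..y}"
    have "p ^ multiplicity p i \<le> y" if "prime p" for p
      using i dvd_imp_le[OF multiplicity_dvd, of i p] by simp
    then have "(\<Prod>p\<in>prime_factors i. p ^ multiplicity p i) dvd (\<Prod>p\<in>prime_factors i. p ^ e p)"
      by (intro prod_dvd_prod le_imp_power_dvd le_e) auto
    also have "\<dots> dvd (\<Prod>p\<in>?A. p ^ e p)"
      using i fin by (intro prod_dvd_prod_subset) (auto dest: dvd_imp_le simp: prime_factors_dvd)
    also have "(\<Prod>p\<in>prime_factors i. p ^ multiplicity p i) = i"
      using i prime_factorization_nat[of i] by simp
    finally show "i dvd (\<Prod>p\<in>?A. p ^ e p)" .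
  qed
  then have "Lcm {1..y} \<le> (\<Prod>p\<in>?A. p ^ e p)"
    by (intro dvd_imp_le) (auto intro!: prod_pos prime_gt_0_nat)
  also have "?A = ?S \<union> ?L"
    by (auto intro: order_trans[OF le_square, folded power2_eq_square])
  also have "(\<Prod>p\<in>?S \<union> ?L. p ^ e p) = (\<Prod>p\<in>?S. p ^ e p) * (\<Prod>p\<in>?L. p ^ e p)"
    using fin by (intro prod.union_disjoint) auto
  also have "(\<Prod>p\<in>?S. p ^ e p) \<le> (\<Prod>p\<in>?S. y)"
    by (intro prod_mono) (auto intro: e_pow)
  also have "(\<Prod>p\<in>?L. p ^ e p) \<le> (\<Prod>p\<in>?L. p)"
  proof (intro prod_mono conjI)
    fix p assume p: "p \<in> ?L"
    have "e p \<le> 1"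
    proof (rule ccontr)
      assume "\<not> e p \<le> 1"
      then have "p\<^sup>2 \<le> p ^ e p"
        using p by (intro power_increasing) (auto dest: prime_ge_1_nat)
      then show False
        using p e_pow[of p] by simp
    qed
    then have "p ^ e p \<le> p ^ 1"
      using p by (intro power_increasing) (auto dest: prime_ge_1_nat)
    then show "p ^ e p \<le> p" by simp
  qed auto
  finally show ?thesis by simp
qed

text \<open>Apart from 2 only odd numbers from 3 up to the largest such prime \<open>k\<close>
  qualify, and \<open>k\<close> is at most the root of \<open>y\<close>.\<close>

lemma card_primes_le_sqrt: "2 * real (card {p. prime p \<and> p\<^sup>2 \<le> y}) \<le> sqrt (real y) + 1"
proof (cases "{p::nat. prime p \<and> p\<^sup>2 \<le> y} = {}")
  case True
  then show ?thesis by (simp only:) simp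
next
  case False
  let ?S = "{p::nat. prime p \<and> p\<^sup>2 \<le> y}"
  have fin: "finite ?S"
    by (rule finite_subset[of _ "{..y}"]) (auto intro: order_trans[OF le_square, folded power2_eq_square])
  define k where "k = Max ?S"
  have k: "prime k" "k\<^sup>2 \<le> y"
    using Max_in[OF fin False] by (auto simp: k_def)
  have "?S \<subseteq> insert 2 ((\<lambda>i. 2 * i + 1) ` {1..(k - 1) div 2})"
  proof
    fix p assume p: "p \<in> ?S"
    then have le: "p \<le> k"
      using Max_ge[OF fin] by (simp add: k_def)
    show "p \<in> insert 2 ((\<lambda>i. 2 * i + 1) ` {1..(k - 1) div 2})"
    proof (cases "p = 2")
      case False
      then have "odd p" "p > 2"
        using p prime_odd_nat[of p] prime_ge_2_nat[of p] by auto
      then obtain i where "p = 2 * i + 1" "i \<ge> 1"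
        by (auto elim!: oddE)
      then show ?thesis
        using le by auto
    qed auto
  qed
  then have "card ?S \<le> card (insert 2 ((\<lambda>i. 2 * i + 1) ` {1..(k - 1) div 2}))"
    by (intro card_mono) auto
  also have "\<dots> \<le> Suc (card ((\<lambda>i::nat. 2 * i + 1) ` {1..(k - 1) div 2}))"
    by (rule card_insert_le_m1) auto
  also have "card ((\<lambda>i::nat. 2 * i + 1) ` {1..(k - 1) div 2}) \<le> (k - 1) div 2"
    using card_image_le[of "{1..(k - 1) div 2}" "\<lambda>i::nat. 2 * i + 1"] by simp
  finally have "2 * card ?S \<le> k + 1"
    using prime_ge_2_nat[OF k(1)] by simp
  then have "2 * real (card ?S) \<le> real k + 1"
    by linarith
  also have "real k \<le> sqrt (real y)"
    using k(2) by (intro real_le_rsqrt) (metis of_nat_le_iff of_nat_power)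
  finally show ?thesis by simp
qed

text \<open>A subset of least cardinality works. That all but one of its members multiply to at most
  \<open>n\<close> later bounds how many primes are used.\<close>

lemma prod_subset_minimal:
  assumes "finite Q" "n < \<Prod>Q"
  obtains P where "P \<subseteq> Q" "n < \<Prod>P" "\<And>p. p \<in> P \<Longrightarrow> \<Prod>(P - {p}) \<le> (n::nat)"
proof -
  define P where "P = (ARG_MIN card P. P \<subseteq> Q \<and> n < \<Prod>P)"
  have P: "P \<subseteq> Q" "n < \<Prod>P" and min: "\<And>R. R \<subseteq> Q \<Longrightarrow> n < \<Prod>R \<Longrightarrow> card P \<le> card R"
    using arg_min_nat_lemma[of "\<lambda>P. P \<subseteq> Q \<and> n < \<Prod>P" Q card] assms by (auto simp: P_def)
  have "\<Prod>(P - {p}) \<le> n" if "p \<in> P" for p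
  proof (rule ccontr)
    assume "\<not> ?thesis"
    then have "card P \<le> card (P - {p})"
      using P by (intro min) auto
    then show False
      using that finite_subset[OF P(1) assms(1)] by (metis card_Diff1_less not_le)
  qed
  then show ?thesis
    using that P by blast
qed

subsection \<open>Primes above \<open>t\<close> with product above \<open>n\<close>\<close>

lemma eight_thirds_le_e: "8 / 3 \<le> exp (1::real)"
proof -
  \<comment> \<open>\<open>25 / 18 = 1 + 1/3 + 1/18\<close> is the quadratic Taylor polynomial at
    \<open>1/3\<close>; its cube exceeds \<open>8 / 3\<close>.\<close>
  have "25 / 18 \<le> exp (1 / 3 :: real)"
    using exp_lower_Taylor_quadratic[of "1 / 3"] by (simp add: power2_eq_square)
  then have "(25 / 18) ^ 3 \<le> exp (1 / 3 :: real) ^ 3"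
    by (intro power_mono) auto
  also have "\<dots> = exp 1"
    by (simp flip: exp_of_nat_mult)
  finally show ?thesis by (simp add: power3_eq_cube)
qed

text \<open>The line \<open>u / exp 1\<close> is tangent to \<open>ln\<close> at
  \<open>exp 1\<close>, which is at least \<open>8 / 3\<close>.\<close>

lemma ln_le_three_eighths:
  fixes u :: real
  assumes "u > 0"
  shows "ln u \<le> 3 / 8 * u"
proof -
  have "ln u = ln (u / exp 1) + 1"
    using assms by (simp add: ln_div)
  also have "\<dots> \<le> u / exp 1"
    using ln_le_minus_one[of "u / exp 1"] assms by simp
  also have "\<dots> \<le> u / (8 / 3)"
    using eight_thirds_le_e assms by (intro divide_left_mono) auto
  finally show ?thesis by simp
qed

context
  fixes x G :: real
  assumes x: "x \<ge> 2" and G: "G = 2 * x / ln x"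
begin

lemma ln_x_pos: "ln x > 0"
  using x by simp

lemma G_ge: "G \<ge> 16 / 3"
  using ln_le_three_eighths[of x] x ln_x_pos unfolding G by (simp add: field_simps)

text \<open>The loss \<open>ln (ln x / 2)\<close> is at most
  \<open>3/8 * (ln x / 2) = 3/16 * ln x\<close>.\<close>

lemma ln_G_ge: "ln G \<ge> 13 / 16 * ln x"
proof -
  have "ln G = ln x - ln (ln x / 2)"
    using x ln_x_pos by (simp add: G ln_div ln_mult)
  moreover have "ln (ln x / 2) \<le> 3 / 8 * (ln x / 2)"
    using ln_x_pos by (intro ln_le_three_eighths) simp
  ultimately show ?thesis by simp
qed

lemma two_G_ln_G_ge: "2 * G * ln G \<ge> 13 / 4 * x"
proof -
  have "2 * G * (13 / 16 * ln x) \<le> 2 * G * ln G"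
    using G_ge ln_G_ge by (intro mult_left_mono) auto
  then show ?thesis
    using ln_x_pos by (simp add: G)
qed

text \<open>One factor \<open>G\<close> is replaced by \<open>16 / 3\<close> or by its value. The
  linear bound serves for small \<open>x\<close>, the other one for large \<open>x\<close>.\<close>

lemma G_square_ge: "2 * G\<^sup>2 * ln G \<ge> 52 / 3 * x" "2 * G\<^sup>2 * ln G \<ge> 13 / 2 * x\<^sup>2 / ln x"
proof -
  have eq: "2 * G\<^sup>2 * ln G = G * (2 * G * ln G)"
    by (simp add: power2_eq_square)
  have "16 / 3 * (13 / 4 * x) \<le> G * (2 * G * ln G)"
    by (rule mult_mono[OF G_ge two_G_ln_G_ge]) (use G_ge x in auto)
  then show "2 * G\<^sup>2 * ln G \<ge> 52 / 3 * x"
    by (simp add: eq)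
  have "G * (13 / 4 * x) \<le> G * (2 * G * ln G)"
    by (rule mult_left_mono[OF two_G_ln_G_ge]) (use G_ge in auto)
  also have "G * (13 / 4 * x) = 13 / 2 * x\<^sup>2 / ln x"
    by (simp add: G power2_eq_square)
  finally show "2 * G\<^sup>2 * ln G \<ge> 13 / 2 * x\<^sup>2 / ln x"
    by (simp add: eq)
qed

end

text \<open>The primes up to \<open>t\<close> cost at most a factor \<open>4^t < exp (2 t)\<close>.\<close>

lemma prod_primes_gt:
  fixes n t :: nat
  assumes "finite Q" "\<And>p. p \<in> Q \<Longrightarrow> prime p" "t > 0" "n > 0"
    and Q: "exp (2 * real t + ln (real n)) \<le> real (\<Prod>Q)"
  shows "n < \<Prod>{p \<in> Q. t < p}"
proof -
  let ?P = "{p \<in> Q. t < p}"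
  have "\<Prod>{p \<in> Q. p \<le> t} dvd \<Prod>{p. prime p \<and> p \<le> t}"
    using assms(2) by (intro prod_dvd_prod_subset) auto
  then have "\<Prod>{p \<in> Q. p \<le> t} \<le> \<Prod>{p. prime p \<and> p \<le> t}"
    by (rule dvd_imp_le) (auto intro!: prod_pos prime_gt_0_nat)
  also have "\<dots> \<le> 4 ^ t"
    by (rule primorial_le)
  finally have small: "\<Prod>{p \<in> Q. p \<le> t} \<le> 4 ^ t" .
  have "Q = {p \<in> Q. p \<le> t} \<union> ?P"
    by auto
  then have "\<Prod>Q = \<Prod>({p \<in> Q. p \<le> t} \<union> ?P)"
    by (rule arg_cong)
  also have "\<dots> = \<Prod>{p \<in> Q. p \<le> t} * \<Prod>?P"
    using assms(1) by (intro prod.union_disjoint) auto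
  finally have "\<Prod>Q \<le> 4 ^ t * \<Prod>?P"
    using small by simp
  then have "real (\<Prod>Q) \<le> real (4 ^ t * \<Prod>?P)"
    by (simp only: of_nat_le_iff)
  then have le: "real (\<Prod>Q) \<le> 4 ^ t * real (\<Prod>?P)"
    by simp
  have "4 < exp (2::real)"
  proof -
    have "(8 / 3)\<^sup>2 \<le> (exp (1::real))\<^sup>2"
      using eight_thirds_le_e by (intro power_mono) auto
    also have "(exp 1)\<^sup>2 = exp (2::real)"
      by (simp flip: exp_of_nat_mult)
    finally show ?thesis by (simp add: power2_eq_square)
  qed
  then have "4 ^ t < exp (2::real) ^ t"
    using assms(3) by (intro power_strict_mono) auto
  then have "4 ^ t * real n < exp (2 * real t) * real n"
    using assms(4) by (simp add: mult.commute flip: exp_of_nat_mult)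
  also have "\<dots> = exp (2 * real t + ln (real n))"
    using assms(4) by (simp add: exp_add)
  also note Q
  also note le
  finally have "real n < real (\<Prod>?P)"
    by (rule mult_left_less_imp_less) simp
  then show ?thesis
    by (simp only: of_nat_less_iff)
qed

section \<open>Cheap sets of primes with large product\<close>

lemma exp_le_272_power: "exp (real k) \<le> (272 / 100) ^ k"
proof -
  have "exp (real k) = exp 1 ^ k"
    by (simp flip: exp_of_nat_mult)
  also have "\<dots> \<le> (272 / 100) ^ k"
    using e_less_272 by (intro power_mono) auto
  finally show ?thesis .
qed

lemma ln_le_if_le_power:
  assumes "0 < x" "x \<le> (8 / 3) ^ k"
  shows "ln x \<le> real k"
proof -
  have "(8 / 3) ^ k \<le> exp (1::real) ^ k"
    by (intro power_mono eight_thirds_le_e) simp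
  then have "x \<le> exp 1 ^ k"
    using assms(2) by simp
  then have "x \<le> exp (real k)"
    by (simp flip: exp_of_nat_mult)
  then show ?thesis
    using assms ln_le_cancel_iff[of x "exp (real k)"] by simp
qed

lemma sum_pred_primes_gt_le:
  assumes "finite Q" "1 + 21 / 20 * real (\<Sum>p\<in>Q. p - 1) \<le> B"
  shows "1 + 21 / 20 * real (\<Sum>p\<in>{p \<in> Q. t < p}. p - 1) \<le> B"
proof -
  have "(\<Sum>p\<in>{p \<in> Q. t < p}. p - 1) \<le> (\<Sum>p\<in>Q. p - 1 :: nat)"
    using assms(1) by (intro sum_mono2) auto
  then have "real (\<Sum>p\<in>{p \<in> Q. t < p}. p - 1) \<le> real (\<Sum>p\<in>Q. p - 1)"
    by (simp only: of_nat_le_iff)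
  then show ?thesis
    using assms(2) by simp
qed

text \<open>On each of five ranges of \<open>x\<close> an initial segment of the primes works: its
  product beats \<open>exp\<close> at the right end, and its cost stays below a lower bound for
  \<open>B\<close> taken at the left end, linear on the first two ranges and quadratic on the
  rest.\<close>

lemma prime_set_small:
  fixes x B :: real
  assumes "2 \<le> x" "x \<le> 80" and B: "B \<ge> 52 / 3 * x" "B \<ge> 13 / 2 * x\<^sup>2 / ln x"
  shows "\<exists>Q::nat set. finite Q \<and> (\<forall>p\<in>Q. prime p) \<and> exp x \<le> real (\<Prod>Q) \<and>
    1 + 21 / 20 * real (\<Sum>p\<in>Q. p - 1) \<le> B"
proof -
  have exp_le: "exp x \<le> y" if "x \<le> real k" "(272 / 100) ^ k \<le> y" for k y
    using that exp_le_272_power[of k] by (meson exp_le_cancel_iff order_trans)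
  \<comment> \<open>Here \<open>x0\<close> is the left end of the range, and \<open>k\<close> bounds
    \<open>ln x\<close> through its right end.\<close>
  have B_ge: "B \<ge> 13 / 2 * x0\<^sup>2 / real k" if "0 < x0" "x0 \<le> x" "x \<le> (8 / 3) ^ k" for x0 k
  proof -
    have "13 / 2 * x0\<^sup>2 / real k \<le> 13 / 2 * x\<^sup>2 / ln x"
      using ln_le_if_le_power[OF _ that(3)] that assms(1)
      by (intro frac_le mult_left_mono power_mono) auto
    then show ?thesis using B(2) by simp
  qed
  consider "x \<le> 5" | "5 \<le> x" "x \<le> 10" | "10 \<le> x" "x \<le> 22" | "22 \<le> x" "x \<le> 40" | "40 \<le> x"
    by linarith
  then show ?thesis
  proof cases
    case 1
    have "exp x \<le> 210"
      by (rule exp_le[of 5]) (use 1 in \<open>auto simp: power_divide\<close>)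
    then show ?thesis
      using B(1) assms(1) by (intro exI[of _ "{2, 3, 5, 7}"]) auto
  next
    case 2
    have "exp x \<le> 30030"
      by (rule exp_le[of 10]) (use 2 in \<open>auto simp: power_divide\<close>)
    then show ?thesis
      using B(1) 2 by (intro exI[of _ "{2, 3, 5, 7, 11, 13}"]) auto
  next
    case 3
    have "exp x \<le> 6469693230"
      by (rule exp_le[of 22]) (use 3 in \<open>auto simp: power_divide\<close>)
    moreover have "B \<ge> 13 / 2 * 10\<^sup>2 / real 4"
      by (rule B_ge) (use 3 in \<open>auto simp: power_divide\<close>)
    ultimately show ?thesis
      by (intro exI[of _ "{2, 3, 5, 7, 11, 13, 17, 19, 23, 29}"]) auto
  next
    case 4
    have "exp x \<le> 614889782588491410"
      by (rule exp_le[of 40]) (use 4 in \<open>auto simp: power_divide\<close>)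
    moreover have "B \<ge> 13 / 2 * 22\<^sup>2 / real 4"
      by (rule B_ge) (use 4 in \<open>auto simp: power_divide\<close>)
    ultimately show ?thesis
      by (intro exI[of _ "{2, 3, 5, 7, 11, 13, 17, 19, 23, 29, 31, 37, 41, 43, 47}"]) auto
  next
    case 5
    have "exp x \<le> 2305567963945518424753102147331756070"
      by (rule exp_le[of 80]) (use assms in \<open>auto simp: power_divide\<close>)
    moreover have "B \<ge> 13 / 2 * 40\<^sup>2 / real 5"
      by (rule B_ge) (use 5 assms in \<open>auto simp: power_divide\<close>)
    ultimately show ?thesis
      by (intro exI[of _ "{2, 3, 5, 7, 11, 13, 17, 19, 23, 29, 31, 37, 41, 43, 47, 53, 59, 61, 67, 71, 73, 79, 83, 89, 97}"]) auto
  qed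
qed

text \<open>Chebyshev's lower bound without the primes up to \<open>z = sqrt y\<close>: in
  \<open>4 ^ m <= Lcm {1..y}\<close> these cost at most \<open>(z + 1) * ln z\<close> in the
  logarithm, which is negligible against \<open>z^2 = y\<close>.\<close>

lemma exp_le_prod_primes:
  fixes x :: real and m :: nat
  defines "y \<equiv> 2 * m + 1"
  assumes "x \<le> 2 / 5 * real y" "y \<ge> 200"
  shows "exp x \<le> real (\<Prod>{p. prime p \<and> y < p\<^sup>2 \<and> p \<le> y})"
proof -
  let ?Q = "{p. prime p \<and> y < p\<^sup>2 \<and> p \<le> y}" and ?k = "card {p. prime p \<and> p\<^sup>2 \<le> y}"
  define z where "z = sqrt (real y)"
  have z2: "z\<^sup>2 = real y"
    by (simp add: z_def)
  have z: "z \<ge> 14"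
    using assms(3) by (auto simp: z_def intro!: real_le_rsqrt)
  have ypos: "real y > 0"
    using assms(3) by simp
  have pos: "real (\<Prod>?Q) > 0"
    by (simp only: of_nat_0_less_iff) (auto intro!: prod_pos prime_gt_0_nat)
  have "4 ^ m \<le> y ^ ?k * \<Prod>?Q"
    using order_trans[OF four_power_le_Lcm Lcm_upto_le[of "2 * m + 1"]] by (simp add: y_def)
  then have "real (4 ^ m) \<le> real (y ^ ?k * \<Prod>?Q)"
    by (simp only: of_nat_le_iff)
  then have le: "4 ^ m \<le> real y ^ ?k * real (\<Prod>?Q)"
    by simp
  have "real (2 * m) * ln 2 = ln (4 ^ m)"
    using ln_realpow[of 2 2] by (simp add: ln_realpow)
  also have "\<dots> \<le> ln (real y ^ ?k * real (\<Prod>?Q))"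
    using le pos ypos by (simp only: ln_le_cancel_iff zero_less_power zero_less_numeral mult_pos_pos)
  also have "\<dots> = real ?k * (2 * ln z) + ln (real (\<Prod>?Q))"
  proof -
    have "ln (real y) = 2 * ln z"
      using z by (simp flip: z2 add: ln_realpow)
    then show ?thesis
      using pos ypos ln_mult_pos[of "real y ^ ?k" "real (\<Prod>?Q)"] by (simp add: ln_realpow)
  qed
  also have "real ?k * (2 * ln z) \<le> (z + 1) * ln z"
  proof -
    have "(2 * real ?k) * ln z \<le> (z + 1) * ln z"
      using z card_primes_le_sqrt[of y] by (intro mult_right_mono) (auto simp: z_def[symmetric])
    then show ?thesis by simp
  qed
  also have "\<dots> \<le> (z + 1) * (z / 16 + 16 / 9)"
  proof -
    \<comment> \<open>The tangent of \<open>ln\<close> at 16, a point near the smallest admissible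
      \<open>z\<close>.\<close>
    have "ln z = ln (z / 16) + 4 * ln 2"
      using z ln_realpow[of 2 4] by (simp add: ln_div)
    also have "\<dots> \<le> (z / 16 - 1) + 4 * (25 / 36)"
      using z ln2_le_25_over_36 by (intro add_mono ln_le_minus_one mult_left_mono) auto
    finally have "ln z \<le> z / 16 + 16 / 9"
      by simp
    then show ?thesis
      using z by (intro mult_left_mono) auto
  qed
  finally have "real (2 * m) * ln 2 \<le> (z + 1) * (z / 16 + 16 / 9) + ln (real (\<Prod>?Q))"
    by simp
  \<comment> \<open>The spare \<open>2/3 - 1/16 - 2/5\<close> of \<open>z^2\<close> absorbs the
    linear and constant terms since \<open>z >= 14\<close>.\<close>
  moreover have "real (2 * m) * (2 / 3) \<le> real (2 * m) * ln 2"
    using ln2_ge_two_thirds by (intro mult_left_mono) auto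
  moreover have "real (2 * m) = z\<^sup>2 - 1"
    unfolding z2 y_def by simp
  moreover have "14 * z \<le> z\<^sup>2"
    using z by (simp add: power2_eq_square)
  moreover have "(z + 1) * (z / 16 + 16 / 9) = z\<^sup>2 / 16 + 265 / 144 * z + 16 / 9"
    by (simp add: field_simps power2_eq_square)
  ultimately have "2 / 5 * z\<^sup>2 \<le> ln (real (\<Prod>?Q))"
    using z by linarith
  then have "x \<le> ln (real (\<Prod>?Q))"
    using assms(2) z2 by simp
  then show ?thesis
    using pos by (simp only: ln_ge_iff)
qed

text \<open>Among the primes between \<open>sqrt y\<close> and \<open>y\<close>, with
  \<open>y\<close> about \<open>5/2 * x\<close>, those above \<open>t\<close> have product above
  \<open>n\<close>. In a minimal such set all members but one exceed \<open>sqrt y\<close> and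
  multiply to at most \<open>n\<close>, so there are at most \<open>1 + 2 * x / ln x\<close> of
  them, each at most \<open>y\<close>.\<close>

lemma prime_set_large:
  fixes n t :: nat and x B :: real
  assumes x: "x = 2 * real t + ln (real n)" "80 \<le> x" and t: "t > 0" and n: "n > 0"
    and B: "B \<ge> 13 / 2 * x\<^sup>2 / ln x"
  shows "\<exists>P. finite P \<and> (\<forall>p\<in>P. prime p \<and> t < p) \<and> n < \<Prod>P \<and>
    1 + 21 / 20 * real (\<Sum>p\<in>P. p - 1) \<le> B"
proof -
  \<comment> \<open>Chosen so that \<open>y\<close> is the least odd number from
    \<open>5/2 * x\<close> on, as \<open>exp x <= \<Prod>Q\<close> requires
    \<open>x <= 2/5 * y\<close>.\<close>
  define m where "m = nat \<lceil>5 / 4 * x - 1 / 2\<rceil>"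
  define y where "y = 2 * m + 1"
  have y: "5 / 2 * x \<le> real y" "real y \<le> 5 / 2 * x + 2"
    unfolding y_def m_def using x(2) by linarith+
  have ypos: "real y > 0"
    using y x by linarith
  let ?Q = "{p. prime p \<and> y < p\<^sup>2 \<and> p \<le> y}"
  have finQ: "finite ?Q"
    by (rule finite_subset[of _ "{..y}"]) auto
  have "exp x \<le> real (\<Prod>?Q)"
    unfolding y_def by (rule exp_le_prod_primes) (use y x in \<open>auto simp: y_def\<close>)
  then have "n < \<Prod>{p \<in> ?Q. t < p}"
    using finQ t n x by (intro prod_primes_gt) auto
  then obtain P where P: "P \<subseteq> {p \<in> ?Q. t < p}" "n < \<Prod>P" "\<And>p. p \<in> P \<Longrightarrow> \<Prod>(P - {p}) \<le> n"
    using prod_subset_minimal[OF finite_subset[OF _ finQ], of "{p \<in> ?Q. t < p}" n] by blast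
  have finP: "finite P"
    by (rule finite_subset[OF _ finQ]) (use P(1) in auto)
  have lnx: "ln x > 0" "ln x \<le> x / 10"
  proof -
    show "ln x > 0" using x by simp
    have "ln x = ln (x / 16) + 4 * ln 2"
      using x(2) ln_realpow[of 2 4] by (simp add: ln_div)
    also have "\<dots> \<le> (x / 16 - 1) + 4 * (25 / 36)"
      using x(2) ln2_le_25_over_36 by (intro add_mono ln_le_minus_one mult_left_mono) auto
    finally show "ln x \<le> x / 10" using x(2) by simp
  qed
  have "real (card P) - 1 \<le> 2 * x / ln x"
  proof (cases "P = {}")
    case True
    moreover have "0 \<le> 2 * x / ln x"
      using lnx x(2) by simp
    ultimately show ?thesis by (simp only: card.empty)
  next
    case False
    then obtain p where p: "p \<in> P" by auto
    have "sqrt (real y) ^ (card P - 1) = (\<Prod>q\<in>P - {p}. sqrt (real y))"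
      using p finP by simp
    also have "\<dots> \<le> (\<Prod>q\<in>P - {p}. real q)"
    proof (intro prod_mono conjI)
      fix q assume "q \<in> P - {p}"
      then have "y < q\<^sup>2"
        using P(1) by auto
      then have "real y \<le> (real q)\<^sup>2"
        by (metis less_imp_le of_nat_le_iff of_nat_power)
      then show "sqrt (real y) \<le> real q"
        by (simp add: real_le_lsqrt)
    qed auto
    also have "\<dots> = real (\<Prod>(P - {p}))"
      by simp
    also have "\<dots> \<le> real n"
      using P(3)[OF p] by (simp only: of_nat_le_iff)
    finally have "ln (sqrt (real y) ^ (card P - 1)) \<le> ln (real n)"
      using ypos n by (subst ln_le_cancel_iff) auto
    then have "real (card P - 1) * (ln (real y) / 2) \<le> ln (real n)"
      using ypos by (simp add: ln_realpow ln_sqrt)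
    also have "\<dots> \<le> x"
      using x(1) by simp
    finally have "real (card P - 1) * ln (real y) \<le> 2 * x"
      by simp
    moreover have "real (card P - 1) * ln x \<le> real (card P - 1) * ln (real y)"
      using x(2) y by (intro mult_left_mono) auto
    ultimately have "real (card P - 1) \<le> 2 * x / ln x"
      using lnx by (simp add: field_simps)
    then show ?thesis by linarith
  qed
  then have cardP: "real (card P) \<le> 1 + 2 * x / ln x"
    by simp
  have "(\<Sum>p\<in>P. p - 1) \<le> (\<Sum>p\<in>P. y)"
    using P(1) by (intro sum_mono) auto
  then have "real (\<Sum>p\<in>P. p - 1) \<le> real (card P * y)"
    by (simp only: of_nat_le_iff sum_constant of_nat_id)
  also have "\<dots> = real (card P) * real y"
    by simp
  also have "\<dots> \<le> (1 + 2 * x / ln x) * (5 / 2 * x + 2)"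
    using cardP y lnx x(2) by (intro mult_mono) auto
  finally have "1 + 21 / 20 * real (\<Sum>p\<in>P. p - 1) \<le> 1 + 21 / 20 * ((1 + 2 * x / ln x) * (5 / 2 * x + 2))"
    by simp
  also have "\<dots> \<le> 13 / 2 * x\<^sup>2 / ln x"
  proof -
    \<comment> \<open>The inequality multiplied by \<open>ln x\<close>. With
      \<open>ln x <= x / 10\<close> the leading coefficient becomes \<open>441/80 < 13/2\<close>,
      and \<open>x >= 80\<close> pays for the linear term.\<close>
    have "ln x + 21 / 20 * ((ln x + 2 * x) * (5 / 2 * x + 2))
        \<le> x / 10 + 21 / 20 * ((x / 10 + 2 * x) * (5 / 2 * x + 2))"
      using lnx x(2) by (intro add_mono mult_left_mono mult_right_mono) auto
    also have "\<dots> \<le> 13 / 2 * x\<^sup>2"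
    proof -
      have "80 * x \<le> x\<^sup>2"
        using x(2) by (simp add: power2_eq_square)
      moreover have "x / 10 + 21 / 20 * ((x / 10 + 2 * x) * (5 / 2 * x + 2)) = 441 / 80 * x\<^sup>2 + 451 / 100 * x"
        by (simp add: field_simps power2_eq_square)
      ultimately show ?thesis
        using x(2) by linarith
    qed
    finally show ?thesis
      using lnx by (simp add: field_simps)
  qed
  finally show ?thesis
    using P B finP by (intro exI[of _ P]) auto
qed

text \<open>In the cost, \<open>p - 1\<close> counts nonzero residues, \<open>21/20\<close>
  anticipates the ratio of the binomial sum to its last term, and 1 accounts for the empty
  set.\<close>

lemma prime_set:
  fixes n t :: nat and x G :: real
  assumes x: "x = 2 * real t + ln (real n)" and t: "t > 0" and n: "n > 0"
    and G: "G = 2 * x / ln x"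
  obtains P where "finite P" "\<And>p. p \<in> P \<Longrightarrow> prime p \<and> t < p" "n < \<Prod>P"
    "1 + 21 / 20 * real (\<Sum>p\<in>P. p - 1) \<le> 2 * G\<^sup>2 * ln G"
proof -
  have "ln (real n) \<ge> 0"
    using n by simp
  then have x2: "x \<ge> 2"
    using x t by linarith
  note B = G_square_ge[OF x2 G]
  show ?thesis
  proof (cases "x \<le> 80")
    case True
    obtain Q where Q: "finite Q" "\<forall>p\<in>Q. prime p" "exp x \<le> real (\<Prod>Q)"
      "1 + 21 / 20 * real (\<Sum>p\<in>Q. p - 1) \<le> 2 * G\<^sup>2 * ln G"
      using prime_set_small[OF x2 True B] by auto
    show ?thesis
    proof (rule that)
      show "n < \<Prod>{p \<in> Q. t < p}"
        using Q t n x by (intro prod_primes_gt) auto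
      show "1 + 21 / 20 * real (\<Sum>p\<in>{p \<in> Q. t < p}. p - 1) \<le> 2 * G\<^sup>2 * ln G"
        using Q by (intro sum_pred_primes_gt_le)
    qed (use Q in auto)
  next
    case False
    then show ?thesis
      using prime_set_large[OF x _ t n B(2)] that by (metis linorder_le_cases)
  qed
qed

subsection \<open>Fractional intersecting families\<close>

text \<open>Each term is at most \<open>s / (n - s + 1)\<close> times its successor, so this is the
  bound by a geometric series, proved without division by induction on \<open>s\<close>.\<close>

lemma sum_choose_le_central:
  assumes "2 * s \<le> n"
  shows "(n - 2 * s + 1) * (\<Sum>i\<le>s. n choose i) \<le> (n - s + 1) * (n choose s)"
  using assms
proof (induction s)
  case 0
  show ?case by simp
next
  case (Suc s)
  define u where "u = n - 2 * Suc s + 1"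
  define v where "v = n - s"
  have uv: "n - 2 * s + 1 = u + 2" "n - s + 1 = v + 1" "n - Suc s + 1 = v" "u \<le> 2 * v" "u \<le> v"
    using Suc.prems by (auto simp: u_def v_def)
  have IH: "(u + 2) * (\<Sum>i\<le>s. n choose i) \<le> (v + 1) * (n choose s)"
    using Suc uv by simp
  have absorb: "v * (n choose s) = Suc s * (n choose Suc s)"
    unfolding v_def by (metis binomial_absorb_comp binomial_absorption)
  \<comment> \<open>The induction hypothesis times \<open>u * v\<close>; absorption then raises
    \<open>s\<close>, and \<open>u * (v + 1) <= (u + 2) * v\<close> lets \<open>v * (u + 2)\<close>
    be cancelled.\<close>
  have "v * ((u + 2) * (u * (\<Sum>i\<le>s. n choose i))) \<le> u * (v * ((v + 1) * (n choose s)))"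
    using mult_left_mono[OF IH, of "u * v"] by (simp add: algebra_simps)
  also have "\<dots> = u * (v + 1) * Suc s * (n choose Suc s)"
    using absorb by (simp add: algebra_simps)
  also have "\<dots> \<le> (u + 2) * v * Suc s * (n choose Suc s)"
    using uv(4) by (intro mult_right_mono) (auto simp: algebra_simps)
  finally have "(v * (u + 2)) * (u * (\<Sum>i\<le>s. n choose i)) \<le> (v * (u + 2)) * (Suc s * (n choose Suc s))"
    by (simp only: mult_ac)
  moreover have "0 < v * (u + 2)"
    using Suc.prems by (simp add: v_def)
  ultimately have "u * (\<Sum>i\<le>s. n choose i) \<le> Suc s * (n choose Suc s)"
    by (simp only: mult_le_cancel1 simp_thms)
  \<comment> \<open>Exactly the room needed for the new summand
    \<open>n choose Suc s\<close>.\<close>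
  moreover have "v = u + Suc s"
    using Suc.prems by (simp add: u_def v_def)
  ultimately have "u * (\<Sum>i\<le>Suc s. n choose i) \<le> v * (n choose Suc s)"
    by (simp add: algebra_simps)
  then show ?case
    by (simp only: u_def[symmetric] uv(3))
qed

lemma card_uniform_le_choose:
  assumes "F \<subseteq> Pow {1..n}"
  shows "card {A \<in> F. card A = k} \<le> n choose k"
proof -
  have "card {A \<in> F. card A = k} \<le> card {A. A \<subseteq> {1..n} \<and> card A = k}"
    using assms by (intro card_mono) auto
  then show ?thesis by (simp add: n_subsets)
qed

section \<open>Bounds by residue classes and by uniform layers\<close>

locale fractional_family =
  fixes n s t :: nat and a b :: "nat \<Rightarrow> nat" and F :: "nat set set"
  assumes family: "fractional_intersecting_family n ((\<lambda>i. real (a i) / real (b i)) ` {1..s}) F"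
    and s_pos: "s > 0"
    and s_le: "s \<le> t"
    and b_le: "i \<in> {1..s} \<Longrightarrow> b i \<le> t"
    and a_less: "i \<in> {1..s} \<Longrightarrow> a i < b i"
begin

lemma subset_Pow: "F \<subseteq> Pow {1..n}"
  using family by (simp add: fractional_intersecting_family_def)

lemma finite_F: "finite F"
  using subset_Pow finite_subset by blast

lemma card_le: "A \<in> F \<Longrightarrow> card A \<le> n"
  using subset_Pow card_mono[of "{1..n}" A] by auto

lemma finite_member: "A \<in> F \<Longrightarrow> finite A"
  using subset_Pow finite_subset by blast

lemma card_inter:
  assumes "A \<in> F" "B \<in> F" "A \<noteq> B"
  obtains l where "l \<in> {1..s}" "b l * card (A \<inter> B) = a l * card A \<or> b l * card (A \<inter> B) = a l * card B"
proof -
  obtain l where l: "l \<in> {1..s}"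
    "real (card (A \<inter> B)) = real (a l) / real (b l) * real (card A) \<or>
     real (card (A \<inter> B)) = real (a l) / real (b l) * real (card B)"
    using family assms unfolding fractional_intersecting_family_def by fastforce
  have "b l > 0"
    using a_less[OF l(1)] by simp
  then have "real (b l * card (A \<inter> B)) = real (a l * card A) \<or> real (b l * card (A \<inter> B)) = real (a l * card B)"
    using l(2) by (auto simp: field_simps)
  then show ?thesis
    using that l(1) of_nat_eq_iff by blast
qed

text \<open>On the diagonal \<open>f A A\<close> is a product of
  \<open>(b l - a l) * card A\<close>, prime to \<open>p\<close> because
  \<open>0 < b l - a l <= t < p\<close> and \<open>j\<close> is nonzero. Off the diagonal some
  factor vanishes modulo \<open>p\<close>: whether the intersection condition refers to
  \<open>card A\<close> or \<open>card B\<close> is immaterial, both being congruent to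
  \<open>j\<close>.\<close>

lemma card_residue_class_le:
  assumes p: "prime p" "t < p" and j: "j \<noteq> 0"
  shows "card {A \<in> F. card A mod p = j} \<le> (\<Sum>i\<le>s. n choose i)"
proof -
  define C where "C = {A \<in> F. card A mod p = j}"
  define f where "f A X = (\<Prod>l = 1..s. int (b l) * int (card (A \<inter> X)) - int (a l) * int (card A))" for A X :: "nat set"
  have "card C \<le> card (monomials n s)"
  proof (rule card_le_span_mod_prime[where f = f and p = "int p"])
    show "finite C"
      using finite_F by (simp add: C_def)
    show "prime (int p)"
      using p by simp
    show "(\<lambda>X. rat_of_int (f A X)) \<in> rat_fun.span (monomials n s)" if "A \<in> C" for A
      using prod_affine_in_span_monomials[of A n "\<lambda>l. of_nat (b l)" "\<lambda>l. - (of_nat (a l) * of_nat (card A))" s]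
        that subset_Pow by (auto simp: f_def C_def)
    show "\<not> int p dvd f A A" if A: "A \<in> C" for A
    proof
      assume "int p dvd f A A"
      then obtain l where l: "l \<in> {1..s}"
        "int p dvd int (b l) * int (card A) - int (a l) * int (card A)"
        using p(1) by (auto simp: f_def prime_dvd_prod_iff)
      then have "int p dvd int ((b l - a l) * card A)"
        using a_less[OF l(1)] by (simp add: left_diff_distrib of_nat_diff)
      then have "p dvd b l - a l \<or> p dvd card A"
        using p(1) by (simp only: int_dvd_int_iff prime_dvd_mult_iff)
      then show False
      proof
        assume "p dvd b l - a l"
        then show False
          using a_less[OF l(1)] b_le[OF l(1)] p(2) nat_dvd_not_less[of "b l - a l" p] by simp
      next
        assume "p dvd card A"
        then show False
          using A j by (auto simp: C_def)
      qed
    qed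
    show "int p dvd f A B" if AB: "A \<in> C" "B \<in> C" "A \<noteq> B" for A B
    proof -
      have "A \<in> F" "B \<in> F"
        using AB by (auto simp: C_def)
      from card_inter[OF this AB(3)] obtain l where l: "l \<in> {1..s}"
        "b l * card (A \<inter> B) = a l * card A \<or> b l * card (A \<inter> B) = a l * card B" .
      have "int (card B) mod int p = int (card A) mod int p"
        using AB by (simp add: C_def flip: zmod_int)
      then have "int p dvd int (card B) - int (card A)"
        by (simp add: mod_eq_dvd_iff)
      then have "int p dvd int (a l) * int (card B) - int (a l) * int (card A)"
        by (metis dvd_mult right_diff_distrib)
      then have "int p dvd int (b l) * int (card (A \<inter> B)) - int (a l) * int (card A)"
        using l(2) by (auto simp flip: of_nat_mult)
      then show ?thesis
        unfolding f_def using l(1) by (meson dvd_prodI dvd_trans finite_atLeastAtMost)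
    qed
  qed auto
  then show ?thesis
    using card_monomials_le[of n s] by (simp add: C_def)
qed

text \<open>Modulo a prime above \<open>n\<close> and \<open>t\<close> the layer lies in a single
  nonzero residue class.\<close>

lemma card_uniform_le:
  assumes "k \<noteq> 0"
  shows "card {A \<in> F. card A = k} \<le> (\<Sum>i\<le>s. n choose i)"
proof -
  obtain p where p: "prime p" "p > max n t"
    using bigger_prime by blast
  have "{A \<in> F. card A = k} \<subseteq> {A \<in> F. card A mod p = k}"
    using p(2) card_le by (auto intro!: mod_less order.strict_trans1[OF card_le])
  then have "card {A \<in> F. card A = k} \<le> card {A \<in> F. card A mod p = k}"
    using finite_F by (intro card_mono) auto
  also have "\<dots> \<le> (\<Sum>i\<le>s. n choose i)"
    using p assms by (intro card_residue_class_le) auto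
  finally show ?thesis .
qed

text \<open>If \<open>2 * s > n\<close>, all layers from \<open>s\<close> on are at most
  \<open>n choose s\<close>. Otherwise the \<open>n - 2 * s + 1\<close> middle layers together cost
  \<open>n - s + 1\<close> copies of \<open>n choose s\<close>, and the top \<open>s\<close> layers
  one copy each.\<close>

lemma card_le_uniform_layers:
  assumes "s \<le> n"
  shows "card F \<le> (\<Sum>i = 1..s - 1. n choose i) + (n + 2) * (n choose s)"
proof -
  have pos: "n choose s \<ge> 1"
    using assms by (simp add: Suc_le_eq)
  \<comment> \<open>The claimed sum starts at 1; the term for the empty set is paid by one more
    \<open>n choose s\<close>, hence \<open>n + 2\<close>.\<close>
  have split0: "(\<Sum>i<s. n choose i) = 1 + (\<Sum>i = 1..s - 1. n choose i)"
  proof -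
    have "{..<s} = insert 0 {1..s - 1}"
      using s_pos by auto
    then show ?thesis by simp
  qed
  have "card F \<le> (\<Sum>i<s. n choose i) + (n + 1) * (n choose s)"
  proof (cases "2 * s \<le> n")
    case False
    have "card F \<le> card (Pow {1..n})"
      using subset_Pow by (intro card_mono) auto
    also have "\<dots> = (\<Sum>i\<le>n. n choose i)"
      by (simp add: card_Pow choose_row_sum)
    also have "{..n} = {..<s} \<union> {s..n}"
      using assms by auto
    also have "(\<Sum>i\<in>{..<s} \<union> {s..n}. n choose i) = (\<Sum>i<s. n choose i) + (\<Sum>i = s..n. n choose i)"
      by (rule sum.union_disjoint) auto
    also have "(\<Sum>i = s..n. n choose i) \<le> (\<Sum>i = s..n. n choose s)"
      using False by (intro sum_mono binomial_antimono) auto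
    also have "\<dots> = (n + 1 - s) * (n choose s)"
      by simp
    also have "\<dots> \<le> (n + 1) * (n choose s)"
      by (intro mult_right_mono) auto
    finally show ?thesis by simp
  next
    case True
    have "F = (\<Union>k\<le>n. {A \<in> F. card A = k})"
      using card_le by auto
    then have "card F \<le> (\<Sum>k\<le>n. card {A \<in> F. card A = k})"
      using card_UN_le[of "{..n}" "\<lambda>k. {A \<in> F. card A = k}"] by simp
    also have "{..n} = {..<s} \<union> ({s..n - s} \<union> {n - s<..n})"
      using True by auto
    also have "(\<Sum>k\<in>{..<s} \<union> ({s..n - s} \<union> {n - s<..n}). card {A \<in> F. card A = k})
      = (\<Sum>k<s. card {A \<in> F. card A = k}) + ((\<Sum>k = s..n - s. card {A \<in> F. card A = k})
         + (\<Sum>k\<in>{n - s<..n}. card {A \<in> F. card A = k}))"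
      using True by (subst sum.union_disjoint sum.union_disjoint; (subst sum.union_disjoint)?) auto
    also have "(\<Sum>k<s. card {A \<in> F. card A = k}) \<le> (\<Sum>k<s. n choose k)"
      using subset_Pow by (intro sum_mono card_uniform_le_choose)
    also have "(\<Sum>k = s..n - s. card {A \<in> F. card A = k}) \<le> (\<Sum>k = s..n - s. (\<Sum>i\<le>s. n choose i))"
      using s_pos by (intro sum_mono card_uniform_le) auto
    also have "\<dots> = (n - 2 * s + 1) * (\<Sum>i\<le>s. n choose i)"
    proof -
      have "card {s..n - s} = n - 2 * s + 1"
        using True by simp
      then show ?thesis
        by (simp only: sum_constant of_nat_id)
    qed
    also have "\<dots> \<le> (n - s + 1) * (n choose s)"
      using True by (rule sum_choose_le_central)
    also have "(\<Sum>k\<in>{n - s<..n}. card {A \<in> F. card A = k}) \<le> (\<Sum>k\<in>{n - s<..n}. n choose s)"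
    proof (rule sum_mono)
      fix k assume k: "k \<in> {n - s<..n}"
      have "card {A \<in> F. card A = k} \<le> n choose (n - k)"
        using card_uniform_le_choose[OF subset_Pow, of k] k binomial_symmetric[of k n] by simp
      also have "\<dots> \<le> n choose s"
        using k True by (intro binomial_mono) auto
      finally show "card {A \<in> F. card A = k} \<le> n choose s" .
    qed
    also have "\<dots> = s * (n choose s)"
      using True by simp
    also have "(\<Sum>k<s. n choose k) + ((n - s + 1) * (n choose s) + s * (n choose s))
        = (\<Sum>k<s. n choose k) + (n + 1) * (n choose s)"
      using assms by (simp flip: add_mult_distrib)
    finally show ?thesis by simp
  qed
  then show ?thesis
    using pos by (simp add: split0)
qed

text \<open>A nonempty member has positive size below the product of \<open>P\<close>, so some
  \<open>p\<close> in \<open>P\<close> does not divide it. The nonzero residue classes modulo these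
  primes thus cover all of \<open>F\<close> but the empty set.\<close>

lemma card_le_primes:
  assumes P: "finite P" "\<And>p. p \<in> P \<Longrightarrow> prime p \<and> t < p" and prod: "n < \<Prod>P"
  shows "card F \<le> 1 + (\<Sum>p\<in>P. p - 1) * (\<Sum>i\<le>s. n choose i)"
proof -
  have *: "\<exists>p\<in>P. card A mod p \<in> {1..<p}" if A: "A \<in> F" "A \<noteq> {}" for A
  proof (rule ccontr)
    assume "\<not> ?thesis"
    then have "p dvd card A" if "p \<in> P" for p
      using P(2)[OF that] that by (auto simp: dvd_eq_mod_eq_0 Suc_le_eq prime_gt_0_nat)
    moreover have "coprime p q" if "p \<in> P" "q \<in> P" "p \<noteq> q" for p q
      using P(2) that by (simp add: primes_coprime)
    ultimately have "\<Prod>P dvd card A"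
      using P(1) by (intro prod_dvd_of_coprime) auto
    then have "\<Prod>P \<le> card A"
      using A finite_member by (intro dvd_imp_le) (auto simp: card_gt_0_iff)
    then show False
      using prod card_le[OF A(1)] by simp
  qed
  have "F \<subseteq> {{}} \<union> (\<Union>p\<in>P. \<Union>j\<in>{1..<p}. {A \<in> F. card A mod p = j})"
    using * by fastforce
  then have "card F \<le> card ({{}} \<union> (\<Union>p\<in>P. \<Union>j\<in>{1..<p}. {A \<in> F. card A mod p = j}))"
    using P(1) finite_F by (intro card_mono) auto
  also have "\<dots> \<le> 1 + card (\<Union>p\<in>P. \<Union>j\<in>{1..<p}. {A \<in> F. card A mod p = j})"
    using card_Un_le[of "{{}}"] by simp
  also have "card (\<Union>p\<in>P. \<Union>j\<in>{1..<p}. {A \<in> F. card A mod p = j})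
      \<le> (\<Sum>p\<in>P. card (\<Union>j\<in>{1..<p}. {A \<in> F. card A mod p = j}))"
    by (rule card_UN_le) fact
  also have "\<dots> \<le> (\<Sum>p\<in>P. (\<Sum>j\<in>{1..<p}. card {A \<in> F. card A mod p = j}))"
    by (intro sum_mono card_UN_le) auto
  also have "\<dots> \<le> (\<Sum>p\<in>P. (\<Sum>j\<in>{1..<p}. (\<Sum>i\<le>s. n choose i)))"
    using P(2) by (intro sum_mono card_residue_class_le) auto
  also have "\<dots> = (\<Sum>p\<in>P. p - 1) * (\<Sum>i\<le>s. n choose i)"
    by (simp add: sum_distrib_right)
  finally show ?thesis by simp
qed

end

text \<open>A small bound forces \<open>t\<close>, and so \<open>s\<close>, to be small against
  \<open>n\<close>; then the binomial sum is barely larger than its last term and the cheap set of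
  primes suffices.\<close>

lemma (in fractional_family) card_le_if_bound_small:
  assumes x: "x = 2 * real t + ln (real n)" and G: "G = 2 * x / ln x"
    and "n > 0" and less: "2 * G\<^sup>2 * ln G < real n + 4"
  shows "real (card F) \<le> 2 * real (n choose s) * G\<^sup>2 * ln G"
proof -
  have t: "t > 0"
    using s_pos s_le by simp
  obtain P where P: "finite P" "\<And>p. p \<in> P \<Longrightarrow> prime p \<and> t < p" "n < \<Prod>P"
    "1 + 21 / 20 * real (\<Sum>p\<in>P. p - 1) \<le> 2 * G\<^sup>2 * ln G"
    using prime_set[OF x t \<open>n > 0\<close> G] by blast
  have "ln (real n) \<ge> 0"
    using \<open>n > 0\<close> by simp
  then have x2: "x \<ge> 2" "x \<ge> 2 * real t"
    using x t by linarith+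
  have "52 / 3 * (2 * real t) < real n + 4"
    using G_square_ge(1)[OF x2(1) G] x2(2) less by linarith
  \<comment> \<open>Equivalent to \<open>20 * (n - s + 1) <= 21 * (n - 2 * s + 1)\<close>, the
    source of the factor \<open>21/20\<close>.\<close>
  then have s22: "22 * s \<le> n + 1"
    using t s_le by linarith
  let ?C = "n choose s" and ?S = "\<Sum>i\<le>s. n choose i"
  have C_pos: "?C \<ge> 1"
    using s22 by (simp add: Suc_le_eq)
  have "(n - 2 * s + 1) * ?S \<le> (n - s + 1) * ?C"
    using s22 by (intro sum_choose_le_central) simp
  then have "(n - 2 * s + 1) * (20 * ?S) \<le> (20 * (n - s + 1)) * ?C"
    by (simp only: mult.assoc mult.left_commute[of _ 20] mult_le_cancel1 simp_thms)
  also have "\<dots> \<le> (21 * (n - 2 * s + 1)) * ?C"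
    using s22 by (intro mult_right_mono) auto
  also have "\<dots> = (n - 2 * s + 1) * (21 * ?C)"
    by (simp only: mult_ac)
  finally have "20 * ?S \<le> 21 * ?C"
    by (subst (asm) mult_le_cancel1) simp
  then have S: "real ?S \<le> 21 / 20 * real ?C"
    by linarith
  have "card F \<le> 1 + (\<Sum>p\<in>P. p - 1) * ?S"
    using P(1-3) by (rule card_le_primes)
  then have "real (card F) \<le> real (1 + (\<Sum>p\<in>P. p - 1) * ?S)"
    by (simp only: of_nat_le_iff)
  also have "\<dots> = 1 + real (\<Sum>p\<in>P. p - 1) * real ?S"
    by (simp only: of_nat_add of_nat_mult of_nat_1)
  also have "\<dots> \<le> real ?C + real (\<Sum>p\<in>P. p - 1) * (21 / 20 * real ?C)"
    using C_pos S by (intro add_mono mult_left_mono of_nat_0_le_iff) auto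
  also have "\<dots> = (1 + 21 / 20 * real (\<Sum>p\<in>P. p - 1)) * real ?C"
    by (simp add: algebra_simps)
  also have "\<dots> \<le> (2 * G\<^sup>2 * ln G) * real ?C"
    using P(4) by (rule mult_right_mono) simp
  finally show ?thesis
    by (simp only: mult_ac)
qed

section \<open>Derivation of the three bounds\<close>

theorem theorem1:
  fixes n s t :: nat and a b :: "nat \<Rightarrow> nat" and L :: "real set" and F :: "nat set set"
  assumes "n > 0"
    and "s > 0"
    and "\<forall>i\<in>{1..s}. b i > 0 \<and> coprime (a i) (b i) \<and> real (a i) / real (b i) \<in> {0..<1}"
    and "inj_on (\<lambda>i. real (a i) / real (b i)) {1..s}"
    and "L = (\<lambda>i. real (a i) / real (b i)) ` {1..s}"
    and "fractional_intersecting_family n L F"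
    and "t = max s (Max (b ` {1..s}))"
  shows "real (card F) \<le> 2 * real (n choose s) * (g t n)\<^sup>2 * ln (g t n)
                          + (\<Sum>i = 1..s - 1. real (n choose i)) * g t n
       \<and> (real s \<le> real n + 1 - 2 * g t n * ln (g t n) \<longrightarrow>
            real (card F) \<le> 2 * real (n choose s) * (g t n)\<^sup>2 * ln (g t n))
       \<and> (\<forall>c1::nat. c1 > 0 \<and> int t > int n - int c1
              \<and> \<not> (c1 = 1 \<and> s > n \<and> F = Pow {1..n}) \<longrightarrow>
            real (card F) \<le> 2 * real c1 * real (n choose s) * g t n * ln (g t n)
                            + real c1 * (\<Sum>i = 1..s - 1. real (n choose i)))"
proof -
  interpret fractional_family n s t a b F
  proof
    show "fractional_intersecting_family n ((\<lambda>i. real (a i) / real (b i)) ` {1..s}) F"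
      using assms by simp
    show "s > 0" "s \<le> t"
      using assms by auto
    show "b i \<le> t" if "i \<in> {1..s}" for i
      using assms that by (auto simp: le_max_iff_disj)
    show "a i < b i" if "i \<in> {1..s}" for i
    proof -
      have "b i > 0" "real (a i) / real (b i) \<in> {0..<1}"
        using assms(3) that by blast+
      then show ?thesis by simp
    qed
  qed
  define x where "x = 2 * real t + ln (real n)"
  define G where "G = g t n"
  have G: "G = 2 * x / ln x"
    by (simp add: G_def g_def x_def)
  have t: "t > 0"
    using s_pos s_le by simp
  have "ln (real n) \<ge> 0"
    using \<open>n > 0\<close> by simp
  then have x2: "x \<ge> 2" "x \<ge> 2 * real t"
    using t unfolding x_def by linarith+
  have G_lnG: "2 * G * ln G \<ge> 13 / 2 * real t"
    using two_G_ln_G_ge[OF x2(1) G] x2(2) by linarith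
  have G_ge1: "G \<ge> 16 / 3"
    using G_ge[OF x2(1) G] .
  let ?C = "real (n choose s)" and ?S = "\<Sum>i = 1..s - 1. real (n choose i)"
  define B where "B = 2 * G\<^sup>2 * ln G"
  have S_nonneg: "?S \<ge> 0"
    by (intro sum_nonneg) auto
  have small: "real (card F) \<le> ?S + (real n + 2) * ?C" if "s \<le> n"
    using of_nat_mono[OF card_le_uniform_layers[OF that], where ?'a = real]
    by (simp add: algebra_simps)
  have F_le: "real (card F) \<le> 2 ^ n"
    using card_mono[OF _ subset_Pow] by (simp add: card_Pow of_nat_mono flip: of_nat_power)
  \<comment> \<open>For \<open>s > n\<close> only the sum survives, one short of the trivial bound
    \<open>2 ^ n\<close>; a factor of at least 2 in front of it makes up for that.\<close>
  have beyond: "?C = 0" "?S = 2 ^ n - 1" if "s > n"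
    using bound_degenerates_when_s_gt_n[OF that, of 1] that by (auto simp: card_Pow)
  have large: "real (card F) \<le> B * ?C" if "B < real n + 4"
    using card_le_if_bound_small[OF x_def G \<open>n > 0\<close>] that by (simp add: B_def mult_ac)
  have main: "real (card F) \<le> B * ?C + ?S * G"
  proof (cases "s \<le> n")
    case True
    have S: "?S \<le> ?S * G"
      using G_ge1 S_nonneg mult_left_mono[of 1 G ?S] by simp
    show ?thesis
    proof (cases "B < real n + 4")
      case True
      then show ?thesis
        using large S S_nonneg by linarith
    next
      case False
      then have "(real n + 2) * ?C \<le> B * ?C"
        by (intro mult_right_mono) auto
      then show ?thesis
        using small[OF True] S by linarith
    qed
  next
    case False
    have "(2 :: real) \<le> 2 ^ n"
      using \<open>n > 0\<close> by (simp add: self_le_power)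
    then have "2 ^ n \<le> (2 ^ n - 1) * (2::real)"
      by simp
    also have "\<dots> \<le> (2 ^ n - 1) * G"
      using G_ge1 by (intro mult_left_mono) auto
    finally have "real (card F) \<le> (2 ^ n - 1) * G"
      using F_le by linarith
    then show ?thesis
      using False by (simp only: beyond not_le mult_zero_right add_0)
  qed
  have a: "real (card F) \<le> B * ?C" if s: "real s \<le> real n + 1 - 2 * G * ln G"
  proof (cases "B < real n + 4")
    case False
    \<comment> \<open>From \<open>2 * G * ln G >= 13/2 * s\<close>. It says
      \<open>n - s + 1 <= 2 * (n - 2 * s + 1)\<close>, so the lower binomials add up to at most
      \<open>2 * ?C\<close>, and \<open>n + 2\<close> grows to the threshold
      \<open>n + 4\<close>.\<close>
    have s3: "3 * s \<le> n + 1"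
      using s G_lnG s_le s_pos by linarith
    then have "2 * s \<le> n"
      using s_pos by simp
    then have "(n - 2 * s + 1) * (\<Sum>i\<le>s. n choose i) \<le> (n - s + 1) * (n choose s)"
      by (rule sum_choose_le_central)
    also have "\<dots> \<le> (2 * (n - 2 * s + 1)) * (n choose s)"
      using s3 s_pos by (intro mult_right_mono) auto
    also have "\<dots> = (n - 2 * s + 1) * (2 * (n choose s))"
      by (simp only: mult_ac)
    finally have le: "(\<Sum>i\<le>s. n choose i) \<le> 2 * (n choose s)"
      by (subst (asm) mult_le_cancel1) simp
    have "(\<Sum>i = 1..s - 1. n choose i) \<le> (\<Sum>i\<le>s. n choose i)"
      by (intro sum_mono2) auto
    then have "real (\<Sum>i = 1..s - 1. n choose i) \<le> real (2 * (n choose s))"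
      using le by (simp only: of_nat_le_iff)
    then have "?S \<le> 2 * ?C"
      by simp
    then have "real (card F) \<le> (real n + 4) * ?C"
      using small \<open>2 * s \<le> n\<close> by (simp add: algebra_simps)
    also have "\<dots> \<le> B * ?C"
      using False by (intro mult_right_mono) auto
    finally show ?thesis .
  qed (rule large)
  have b: "real (card F) \<le> (real c1 * (2 * G * ln G)) * ?C + real c1 * ?S"
    if c1: "c1 > 0" "int t > int n - int c1" "\<not> (c1 = 1 \<and> s > n \<and> F = Pow {1..n})" for c1 :: nat
  proof (cases "s \<le> n")
    case True
    \<comment> \<open>\<open>n <= c1 + t - 1 <= c1 * t\<close>, as \<open>(c1 - 1) * (t - 1)\<close>
      is nonnegative.\<close>
    have "n \<le> c1 * t"
    proof -
      obtain c' t' where "c1 = Suc c'" "t = Suc t'"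
        using c1(1) t by (metis Suc_pred)
      then show ?thesis
        using c1(2) by simp
    qed
    then have "real n \<le> real c1 * real t"
      by (metis of_nat_le_iff of_nat_mult)
    moreover have "real c1 * (13 / 2 * real t) \<le> real c1 * (2 * G * ln G)"
      using G_lnG by (intro mult_left_mono) auto
    moreover have "real n \<ge> 1"
      using \<open>n > 0\<close> by simp
    ultimately have "real n + 2 \<le> real c1 * (2 * G * ln G)"
      by linarith
    then have "(real n + 2) * ?C \<le> (real c1 * (2 * G * ln G)) * ?C"
      by (intro mult_right_mono) auto
    moreover have "?S \<le> real c1 * ?S"
      using c1(1) S_nonneg mult_right_mono[of 1 "real c1" ?S] by simp
    ultimately show ?thesis
      using small[OF True] by linarith
  next
    case False
    have two: "(2 :: real) \<le> 2 ^ n"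
      using \<open>n > 0\<close> by (simp add: self_le_power)
    \<comment> \<open>For \<open>c1 = 1\<close> the excluded case leaves a proper subset of the
      power set; for \<open>c1 >= 2\<close> the factor suffices.\<close>
    have "real (card F) \<le> real c1 * (2 ^ n - 1)"
    proof (cases "c1 = 1")
      case True
      then have "F \<subset> Pow {1..n}"
        using c1(3) False subset_Pow by auto
      then have "card F < 2 ^ n"
        using psubset_card_mono[of "Pow {1..n}" F] by (simp add: card_Pow)
      then have "real (Suc (card F)) \<le> real (2 ^ n)"
        by (simp only: of_nat_le_iff Suc_le_eq)
      then show ?thesis
        using True by simp
    next
      case c: False
      have "real (card F) \<le> 2 * (2 ^ n - 1)"
        using F_le two by argo
      also have "\<dots> \<le> real c1 * (2 ^ n - 1)"
        using c c1(1) two by (intro mult_right_mono) auto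
      finally show ?thesis .
    qed
    then show ?thesis
      using False by (simp only: beyond not_le mult_zero_right add_0)
  qed
  show ?thesis
    using main a b unfolding G_def[symmetric] B_def by (simp add: mult_ac)
qed

end
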